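(* Let $n\geq 1$ and let $(K_1,\ldots,K_n)$ be the random tuple associated with the sock sorting process for $n$ pairs of socks, i.e. $K_i$ is the number of socks on the table immediately before the draw at which the $i$th pair is matched. Let $(k_1,k_2,\ldots,k_n)\in\mathbb N^n$, where $\mathbb N=\{1,2,3,\ldots\}$. If $$k_{i+1}\geq k_i-1 \text{ for all } 1\leq i<n \quad\text{and}\quad k_n=1,$$ then $$\mathbb P(K_1=k_1,K_2=k_2,\ldots,K_n=k_n)=2^n\,\frac{n!\prod_{i=1}^n k_i}{(2n)!}.$$ Otherwise, i.e. if $(k_1,\ldots,k_n)\in\mathbb N^n$ does not satisfy this condition, then $\mathbb P(K_1=k_1,\ldots,K_n=k_n)=0$.
   Context: Sock sorting process: there are $n$ different pairs of socks, i.e. the set of $2n$ distinguishable socks $\{1,\ldots,n\}\times\{0,1\}$, where the first coordinate is the type of the sock and the second indicates which of the two partners it is. The socks are drawn one by one without replacement in a uniformly random order: the probability space $\Omega_n$ consists of all $(2n)!$ orderings $\omega=(\omega_1,\ldots,\omega_{2n})$ of the socks, each equally likely. Write $\omega_m=(s_m,p_m)$. If a drawn sock matches a sock on the table, both are removed; otherwise the drawn sock is put on the table. Thus the number $X_m$ of socks on the table after the $m$th draw is given by $X_0=0$ and, for $1\leq m\leq 2n$, $X_m=X_{m-1}+1$ if $s_m\notin\{s_1,\ldots,s_{m-1}\}$, and $X_m=X_{m-1}-1$ if $s_m\in\{s_1,\ldots,s_{m-1}\}$. The path $(X_1,\ldots,X_{2n})$ has exactly $n$ downward steps, and $K_1,\ldots,K_n$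 are the heights from which the successive downward steps are taken: set $L_0=0$ and, inductively for $j=1,\ldots,n$, $L_j=\min\{i>L_{j-1}: X_{i+1}=X_i-1\}$ (with $i\leq 2n-1$) and $K_j=X_{L_j}$. *)

theory Defs
  imports "HOL-Probability.Probability" "HOL-Combinatorics.Multiset_Permutations"
begin

definition socks :: "nat \<Rightarrow> (nat \<times> nat) set" where
  "socks n = {1..n} \<times> {0, 1}"

(* Uniform distribution on the (2n)! orderings of the socks. List positions start at 0,
   so the m-th drawn sock is "w ! (m - 1)". *)
definition sock_orderings :: "nat \<Rightarrow> (nat \<times> nat) list pmf" where
  "sock_orderings n = pmf_of_set (permutations_of_set (socks n))"

(* on_table w m is X_m, to be used for m \<le> length w. It is an int so that the
   downward step is not truncated subtraction. *)
primrec on_table :: "(nat \<times> nat) list \<Rightarrow> nat \<Rightarrow> int" where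
  "on_table w 0 = 0"
| "on_table w (Suc m) =
     (if fst (w ! m) \<notin> fst ` set (take m w) then on_table w m + 1 else on_table w m - 1)"

(* L_j for j \<le> n, where length w = 2n. Further downward steps do not exist, so for j > n
   the value of LEAST is unspecified. *)
primrec match_time :: "(nat \<times> nat) list \<Rightarrow> nat \<Rightarrow> nat" where
  "match_time w 0 = 0"
| "match_time w (Suc j) =
     (LEAST i. match_time w j < i \<and> i \<le> length w - 1 \<and> on_table w (i + 1) = on_table w i - 1)"

(* K_j *)
definition match_height :: "(nat \<times> nat) list \<Rightarrow> nat \<Rightarrow> int" where
  "match_height w j = on_table w (match_time w j)"

end

theory Submission
  imports Defs
begin

text \<open>
  Suppose \<open>t\<close> types have exactly one undrawn sock and \<open>u\<close> types have two. The next draw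
  goes up in \<open>2 * u\<close> ways and down in \<open>t\<close> ways, and which of the two happens is dictated by
  comparing \<open>t\<close> with the next prescribed height \<open>k\<close>: up if \<open>k > t\<close>, down if \<open>k = t\<close>,
  impossible if \<open>k < t\<close>. Hence the up draws contribute the factor \<open>2 ^ n * n!\<close> in total and
  the down draws the product of the prescribed heights.
\<close>

section \<open>Heights of an ordering and the closed form of the count\<close>

text \<open>A draw is downward iff its type does not occur among the \<^emph>\<open>later\<close> draws. This makes
  the recursion depend on the undrawn socks only; \<open>h\<close> is the current height.\<close>

primrec heights :: "int \<Rightarrow> ('a \<times> 'b) list \<Rightarrow> int list" where
  "heights h [] = []"
| "heights h (x # v) =
     (if fst x \<in> fst ` set v then heights (h + 1) v else h # heights (h - 1) v)"

text \<open>\<open>t\<close> is the number of socks on the table. Only upward steps precede the next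
  match, so \<open>t \<le> k\<close>; after it \<open>k - 1\<close> socks remain, and the table must
  end empty.\<close>

primrec admissible :: "nat \<Rightarrow> nat list \<Rightarrow> bool" where
  "admissible t [] \<longleftrightarrow> t = 0"
| "admissible t (k # ks) \<longleftrightarrow> t \<le> k \<and> admissible (k - 1) ks"

text \<open>For a set \<open>S\<close> of undrawn socks these are the ones whose partner lies on the
  table.\<close>

definition lone :: "('a \<times> 'b) set \<Rightarrow> ('a \<times> 'b) set" where
  "lone S = {x \<in> S. fst x \<notin> fst ` (S - {x})}"

definition height_count :: "nat \<Rightarrow> nat \<Rightarrow> nat list \<Rightarrow> nat" where
  "height_count t u ks = (if admissible t ks then 2 ^ u * fact u * prod_list ks else 0)"

text \<open>A match is the last draw of its type, so each type contributes one height.\<close>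

lemma length_heights: "length (heights h v) = card (fst ` set v)"
  by (induction v arbitrary: h) (auto simp: card_insert_if)

text \<open>Each match lowers the table by one sock, so clearing \<open>t\<close> socks takes at
  least \<open>t\<close> matches.\<close>

lemma admissible_imp_le_length: "admissible t ks \<Longrightarrow> t \<le> length ks"
proof (induction ks arbitrary: t)
  case (Cons k ks)
  then have "k - 1 \<le> length ks" "t \<le> k" by auto
  then show ?case by simp
qed auto

text \<open>The closed form obeys the recursion by the next draw: \<open>2 * u\<close> socks lead
  up, \<open>t\<close> socks lead down, the latter from height \<open>t\<close>.\<close>

lemma height_count_Cons:
  assumes "length (k # ks) = t + u"
  shows "height_count t u (k # ks) = 2 * u * height_count (t + 1) (u - 1) (k # ks)
           + (if k = t then t * height_count (t - 1) u ks else 0)"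
proof (cases "k > t")
  case False
  \<comment> \<open>For \<open>k < t\<close> all terms are 0. For \<open>k = t\<close> the upward
    term is 0 because \<open>t + 1 > k\<close>, and \<open>t\<close> is the factor \<open>k\<close>
    of the product.\<close>
  then show ?thesis
    by (auto simp: height_count_def)
next
  case True
  show ?thesis
  proof (cases u)
    case 0
    \<comment> \<open>Without complete pairs only \<open>t - 1\<close> heights follow
      \<open>k\<close>, too few to clear \<open>k - 1 \<ge> t\<close> socks.\<close>
    have "\<not> admissible (k - 1) ks"
      using admissible_imp_le_length[of "k - 1" ks] True assms 0 by auto
    then show ?thesis
      using True 0 by (simp add: height_count_def)
  next
    case (Suc m)
    then show ?thesis
      using True by (simp add: height_count_def algebra_simps)
  qed
qed

section \<open>Effect of one draw on the lone socks\<close>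

text \<open>No other sock of \<open>S\<close> has the type of \<open>x\<close>, so the status of the
  others is unchanged.\<close>

lemma lone_remove_lone:
  assumes "x \<in> lone S"
  shows "lone (S - {x}) = lone S - {x}"
proof -
  have x: "x \<in> S" "fst x \<notin> fst ` (S - {x})" using assms by (auto simp: lone_def)
  have "z \<in> lone (S - {x}) \<longleftrightarrow> z \<in> lone S" if "z \<in> S" "z \<noteq> x" for z
  proof -
    have "S - {z} = insert x (S - {x} - {z})" using x that by blast
    then have "fst ` (S - {z}) = insert (fst x) (fst ` (S - {x} - {z}))" by simp
    moreover have "fst z \<noteq> fst x" using x(2) that by (metis Diff_iff image_eqI singletonD)
    ultimately show ?thesis using that by (simp add: lone_def)
  qed
  moreover have "lone (S - {x}) \<subseteq> S - {x}" "lone S \<subseteq> S" by (auto simp: lone_def)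
  ultimately show ?thesis by blast
qed

text \<open>With at most two socks per type in \<open>S\<close>, removing \<open>x\<close> leaves
  its partner \<open>y\<close> as the only sock of that type and affects no other type.\<close>

lemma lone_remove_paired:
  assumes "x \<in> S" "y \<in> S" "x \<noteq> y" "fst x = fst y"
    and "\<And>a b c. a \<in> S \<Longrightarrow> b \<in> S \<Longrightarrow> c \<in> S \<Longrightarrow> fst a = fst b \<Longrightarrow> fst b = fst c
           \<Longrightarrow> a = b \<or> b = c \<or> a = c"
  shows "lone (S - {x}) = insert y (lone S)" "y \<notin> lone S"
proof -
  have "fst x \<in> fst ` (S - {y})" using assms(1,3) by blast
  then show "y \<notin> lone S"
    using assms(4) by (simp add: lone_def)
  have "fst y \<in> fst ` (S - {x})" using assms(2,3) by blast
  then have "x \<notin> lone S" using assms(4) by (simp add: lone_def)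
  moreover have "y \<in> lone (S - {x})"
  proof -
    have "fst a \<noteq> fst y" if "a \<in> S - {x} - {y}" for a
      using that assms(5)[of x y a] assms(1-4) by auto
    then have "fst y \<notin> fst ` (S - {x} - {y})" by (metis imageE)
    then show ?thesis using assms(2,3) by (simp add: lone_def)
  qed
  moreover have "z \<in> lone (S - {x}) \<longleftrightarrow> z \<in> lone S" if "z \<in> S" "z \<noteq> x" "z \<noteq> y" for z
  proof -
    have "fst z \<noteq> fst x"
      using that assms(5)[of x y z] assms(1-4) by auto
    moreover have "S - {z} = insert x (S - {x} - {z})" using assms(1) that by blast
    then have "fst ` (S - {z}) = insert (fst x) (fst ` (S - {x} - {z}))" by simp
    ultimately show ?thesis using that by (simp add: lone_def)
  qed
  moreover have "lone (S - {x}) \<subseteq> S - {x}" "lone S \<subseteq> S" by (auto simp: lone_def)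
  ultimately show "lone (S - {x}) = insert y (lone S)" by blast
qed

section \<open>Counting orderings with prescribed heights\<close>

text \<open>Induction on \<open>card S\<close>, splitting by the first draw. As types have at most
  two socks, \<open>u\<close> is the number of complete pairs, and the \<open>t + u\<close>
  remaining types give one height each.\<close>

lemma card_heights:
  assumes "finite S"
    and "\<And>a b c. a \<in> S \<Longrightarrow> b \<in> S \<Longrightarrow> c \<in> S \<Longrightarrow> fst a = fst b \<Longrightarrow> fst b = fst c
           \<Longrightarrow> a = b \<or> b = c \<or> a = c"
    and "card (lone S) = t" and "card S = t + 2 * u" and "length ks = t + u"
  shows "card {v \<in> permutations_of_set S. heights (int t) v = map int ks} = height_count t u ks"
  using assms
proof (induction "card S" arbitrary: S t u ks)
  case 0
  then have "S = {}" "t = 0" "u = 0" "ks = []" by auto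
  moreover have "{v. v = [] \<and> heights 0 v = []} = {[] :: ('a \<times> 'b) list}" by auto
  ultimately show ?case
    by (simp add: height_count_def)
next
  case (Suc m)
  then have fin: "finite S" and "S \<noteq> {}" and "ks \<noteq> []" by auto
  then obtain k ks' where ks: "ks = k # ks'" by (cases ks) auto
  define A where "A x = {v \<in> permutations_of_set (S - {x}). heights (int t) (x # v) = map int ks}" for x
  have lone_sub: "lone S \<subseteq> S" by (auto simp: lone_def)
  have fin_lone: "finite (lone S)" using lone_sub fin by (rule finite_subset)
  have "{v \<in> permutations_of_set S. heights (int t) v = map int ks} = (\<Union>x\<in>S. (#) x ` A x)"
    unfolding permutations_of_set_nonempty[OF \<open>S \<noteq> {}\<close>] A_def by blast
  moreover have "card (\<Union>x\<in>S. (#) x ` A x) = (\<Sum>x\<in>S. card ((#) x ` A x))"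
    by (rule card_UN_disjoint) (auto simp: fin A_def)
  moreover have "card ((#) x ` A x) = card (A x)" for x
    by (rule card_image) auto
  ultimately have "card {v \<in> permutations_of_set S. heights (int t) v = map int ks}
      = (\<Sum>x\<in>S. card (A x))" by simp
  also have "\<dots> = (\<Sum>x\<in>S - lone S. card (A x)) + (\<Sum>x\<in>lone S. card (A x))"
    by (rule sum.subset_diff[OF lone_sub fin])
  \<comment> \<open>A lone sock goes down and records height \<open>t\<close>, which forces
    \<open>k = t\<close>.\<close>
  also have "(\<Sum>x\<in>lone S. card (A x)) = (\<Sum>x\<in>lone S. if k = t then height_count (t - 1) u ks' else 0)"
  proof (rule sum.cong[OF refl])
    fix x assume x: "x \<in> lone S"
    then have xS: "x \<in> S" and t: "t \<ge> 1"
      using lone_sub Suc.prems(3) fin_lone card_gt_0_iff[of "lone S"] by auto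
    have "A x = {v \<in> permutations_of_set (S - {x}). k = t \<and> heights (int (t - 1)) v = map int ks'}"
      using x t unfolding A_def lone_def
      by (auto simp: permutations_of_setD ks of_nat_diff dest: permutations_of_setD)
    moreover have "card {v \<in> permutations_of_set (S - {x}). heights (int (t - 1)) v = map int ks'}
        = height_count (t - 1) u ks'"
    proof (rule Suc.hyps(1))
      show "m = card (S - {x})" using Suc.hyps(2) xS by simp
      show "card (lone (S - {x})) = t - 1"
        using lone_remove_lone[OF x] x Suc.prems(3) by simp
      show "card (S - {x}) = t - 1 + 2 * u" using Suc.prems(4) xS t by simp
      show "length ks' = t - 1 + u" using Suc.prems(5) ks t by simp
    qed (use fin Suc.prems(2) in blast)+
    ultimately show "card (A x) = (if k = t then height_count (t - 1) u ks' else 0)"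
      by auto
  qed
  also have "\<dots> = (if k = t then t * height_count (t - 1) u ks' else 0)"
    using Suc.prems(3) by simp
  \<comment> \<open>A sock from a complete pair goes up: its partner becomes lone and
    \<open>ks\<close> stays unconsumed.\<close>
  also have "(\<Sum>x\<in>S - lone S. card (A x)) = (\<Sum>x\<in>S - lone S. height_count (t + 1) (u - 1) ks)"
  proof (rule sum.cong[OF refl])
    fix x assume x: "x \<in> S - lone S"
    then obtain y where y: "y \<in> S" "x \<noteq> y" "fst x = fst y" by (auto simp: lone_def)
    have xS: "x \<in> S" using x by simp
    have rem: "lone (S - {x}) = insert y (lone S)" "y \<notin> lone S"
      by (rule lone_remove_paired[OF xS y]; use Suc.prems(2) in blast)+
    have "card (lone S) < card S"
      using x lone_sub fin by (intro psubset_card_mono) auto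
    then have u: "u \<ge> 1" using Suc.prems(3,4) by simp
    have "A x = {v \<in> permutations_of_set (S - {x}). heights (int (t + 1)) v = map int ks}"
      using x unfolding A_def lone_def by (auto dest: permutations_of_setD simp: add.commute)
    also have "card \<dots> = height_count (t + 1) (u - 1) ks"
    proof (rule Suc.hyps(1))
      show "m = card (S - {x})" using Suc.hyps(2) x by simp
      show "card (lone (S - {x})) = t + 1"
        using rem x Suc.prems(3) fin_lone by simp
      show "card (S - {x}) = t + 1 + 2 * (u - 1)" using Suc.prems(4) x u by simp
      show "length ks = t + 1 + (u - 1)" using Suc.prems(5) u by simp
    qed (use fin Suc.prems(2) in blast)+
    finally show "card (A x) = height_count (t + 1) (u - 1) ks" .
  qed
  also have "\<dots> = 2 * u * height_count (t + 1) (u - 1) ks"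
    using Suc.prems(3,4) lone_sub fin_lone by (simp add: card_Diff_subset)
  finally show ?case
    using height_count_Cons[of k ks' t u] Suc.prems(5) ks by simp
qed

section \<open>From the sock process to \<open>heights\<close>\<close>

text \<open>The unique partner is drawn either before or after position \<open>m\<close>; this links
  the backward-looking \<open>on_table\<close> with the forward-looking
  \<open>heights\<close>.\<close>

lemma permutation_socks_seen_iff:
  assumes w: "w \<in> permutations_of_set (socks n)" and m: "m < length w"
  shows "fst (w ! m) \<in> fst ` set (take m w) \<longleftrightarrow> fst (w ! m) \<notin> fst ` set (drop (Suc m) w)"
proof -
  have split: "w = take m w @ w ! m # drop (Suc m) w"
    using m by (rule id_take_nth_drop)
  have set: "set w = socks n" and dist: "distinct w"
    using w by (auto dest: permutations_of_setD)
  have wm: "w ! m \<in> socks n" using set m nth_mem by blast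
  \<comment> \<open>The partner: \<open>1 - snd\<close> swaps 0 and 1.\<close>
  define y where "y = (fst (w ! m), 1 - snd (w ! m))"
  have y: "y \<in> socks n" "y \<noteq> w ! m"
    using wm by (auto simp: y_def socks_def)
  define T D where "T = set (take m w)" and "D = set (drop (Suc m) w)"
  have socks: "socks n = T \<union> {w ! m} \<union> D"
    using arg_cong[OF split, of set] set by (simp add: T_def D_def)
  have "distinct (take m w @ w ! m # drop (Suc m) w)"
    using dist by (simp only: split[symmetric])
  then have disj: "w ! m \<notin> T" "w ! m \<notin> D" "T \<inter> D = {}"
    by (auto simp: T_def D_def)
  have uniq: "a = y" if "a \<in> T \<union> D" "fst a = fst (w ! m)" for a
  proof -
    have "a \<in> socks n" "a \<noteq> w ! m"
      using that(1) socks disj by auto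
    then show ?thesis
      using that(2) wm by (cases a; cases "w ! m") (auto simp: socks_def y_def)
  qed
  have "fst (w ! m) \<in> fst ` C \<longleftrightarrow> y \<in> C" if "C \<subseteq> T \<union> D" for C
  proof
    assume "fst (w ! m) \<in> fst ` C"
    then obtain a where "a \<in> C" "fst a = fst (w ! m)" by (metis imageE)
    then show "y \<in> C" using uniq that by blast
  next
    assume "y \<in> C"
    moreover have "fst y = fst (w ! m)" by (simp add: y_def)
    ultimately show "fst (w ! m) \<in> fst ` C" by (metis imageI)
  qed
  then have "fst (w ! m) \<in> fst ` T \<longleftrightarrow> y \<in> T" "fst (w ! m) \<in> fst ` D \<longleftrightarrow> y \<in> D"
    by blast+
  moreover have "y \<in> T \<longleftrightarrow> y \<notin> D"
    using y socks disj(3) by blast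
  ultimately show ?thesis by (simp add: T_def D_def)
qed

lemma on_table_down_iff:
  "on_table w (m + 1) = on_table w m - 1 \<longleftrightarrow> fst (w ! m) \<in> fst ` set (take m w)"
  by simp

lemma heights_drop_eq_map_on_table:
  assumes w: "w \<in> permutations_of_set (socks n)" and "i \<le> length w"
  shows "heights (on_table w i) (drop i w) =
    map (on_table w) (filter (\<lambda>m. on_table w (m + 1) = on_table w m - 1) [i..<length w])"
  using assms(2)
proof (induction i rule: inc_induct)
  case (step m)
  then have "drop m w = w ! m # drop (Suc m) w" "[m..<length w] = m # [Suc m..<length w]"
    by (auto simp: Cons_nth_drop_Suc upt_conv_Cons)
  then show ?case
    using step permutation_socks_seen_iff[OF w, of m] unfolding on_table_down_iff
    by (simp split: if_splits)
qed simp

section \<open>Match times as entries of a filtered list\<close>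

text \<open>The search for the first match time starts strictly above 0, so position 0 must not
  qualify; the first draw is indeed never a match.\<close>

lemma nth_filter_upt_0:
  assumes "xs = filter P [0..<N]" "xs \<noteq> []" "\<not> P 0"
  shows "xs ! 0 = (LEAST i. 0 < i \<and> i < N \<and> P i)"
proof (rule Least_equality[symmetric])
  have "xs ! 0 \<in> set xs" using assms(2) by simp
  then show "0 < xs ! 0 \<and> xs ! 0 < N \<and> P (xs ! 0)"
    using assms(1,3) by (auto intro: gr0I)
  fix i assume "0 < i \<and> i < N \<and> P i"
  then have "i \<in> set xs" using assms(1) by simp
  then obtain j where "j < length xs" "xs ! j = i" by (auto simp: in_set_conv_nth)
  moreover have "sorted xs" using assms(1) by (simp add: sorted_wrt_filter)
  ultimately show "xs ! 0 \<le> i" using sorted_nth_mono by blast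
qed

lemma nth_filter_upt_Suc:
  assumes "xs = filter P [0..<N]" "Suc j < length xs"
  shows "xs ! Suc j = (LEAST i. xs ! j < i \<and> i < N \<and> P i)"
proof (rule Least_equality[symmetric])
  have sorted: "sorted_wrt (<) xs" using assms(1) by (simp add: sorted_wrt_filter)
  have "xs ! Suc j \<in> set xs" using assms(2) by simp
  then show "xs ! j < xs ! Suc j \<and> xs ! Suc j < N \<and> P (xs ! Suc j)"
    using assms sorted_wrt_nth_less[OF sorted, of j "Suc j"] by auto
  fix i assume i: "xs ! j < i \<and> i < N \<and> P i"
  then have "i \<in> set xs" using assms(1) by simp
  then obtain l where l: "l < length xs" "xs ! l = i" by (auto simp: in_set_conv_nth)
  have "\<not> l < j" "l \<noteq> j"
    using i l assms(2) sorted_wrt_nth_less[OF sorted, of l j] by auto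
  then show "xs ! Suc j \<le> i"
    using l sorted_wrt_nth_less[OF sorted, of "Suc j" l] by (cases "l = Suc j") auto
qed

lemma match_time_eq_nth:
  fixes w defines "xs \<equiv> filter (\<lambda>m. on_table w (m + 1) = on_table w m - 1) [0..<length w]"
  assumes "j < length xs"
  shows "match_time w (Suc j) = xs ! j"
  using assms(2)
proof (induction j)
  case 0
  \<comment> \<open>Nonemptiness turns the bound \<open>i \<le> length w - 1\<close> into
    \<open>i < length w\<close>.\<close>
  then have "w \<noteq> []" "xs \<noteq> []" by (auto simp: xs_def)
  then show ?case
    using nth_filter_upt_0[OF xs_def[THEN meta_eq_to_obj_eq]]
    by (simp add: Suc_le_eq flip: less_Suc_eq_le)
next
  case (Suc j)
  then have "w \<noteq> []" by (auto simp: xs_def)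
  moreover from Suc have "match_time w (Suc j) = xs ! j" by simp
  ultimately show ?case
    using nth_filter_upt_Suc[OF xs_def[THEN meta_eq_to_obj_eq] Suc.prems]
    by (simp flip: less_Suc_eq_le del: on_table.simps)
qed

lemma heights_eq_map_match_height:
  assumes w: "w \<in> permutations_of_set (socks n)"
  shows "heights 0 w = map (match_height w) [1..<Suc n]"
proof (rule nth_equalityI)
  \<comment> \<open>There are \<open>n\<close> types, hence \<open>n\<close> matches, so each
    \<open>LEAST\<close> up to the \<open>n\<close>-th is attained.\<close>
  have "fst ` socks n = {1..n}" by (force simp: socks_def)
  then show len: "length (heights 0 w) = length (map (match_height w) [1..<Suc n])"
    using w by (simp add: length_heights permutations_of_setD)
  fix j assume "j < length (heights 0 w)"
  then show "heights 0 w ! j = map (match_height w) [1..<Suc n] ! j"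
    using heights_drop_eq_map_on_table[OF w, of 0] match_time_eq_nth[of j w] len
    by (simp add: match_height_def del: match_time.simps on_table.simps(2) upt_Suc)
qed

section \<open>The condition on the heights and the probability\<close>

lemma admissible_map_upt:
  fixes k :: "nat \<Rightarrow> nat"
  assumes "a \<le> n" and "\<forall>i\<in>{1..n}. k i \<ge> 1" and "1 \<le> a"
  shows "admissible t (map k [a..<Suc n]) \<longleftrightarrow>
    t \<le> k a \<and> (\<forall>i. a \<le> i \<and> i < n \<longrightarrow> int (k (i + 1)) \<ge> int (k i) - 1) \<and> k n = 1"
  using assms(1,3)
proof (induction a arbitrary: t rule: inc_induct)
  case base
  \<comment> \<open>Positivity turns the final requirement \<open>k n - 1 = 0\<close> into
    \<open>k n = 1\<close>.\<close>
  then have "k n \<ge> 1" using assms(2) by simp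
  then show ?case by auto
next
  case (step a)
  have "a \<le> i \<and> i < n \<longleftrightarrow> i = a \<or> Suc a \<le> i \<and> i < n" for i
    using step.hyps by auto
  moreover have "int (k (a + 1)) \<ge> int (k a) - 1 \<longleftrightarrow> k a - 1 \<le> k (Suc a)"
    by auto
  ultimately have "(\<forall>i. a \<le> i \<and> i < n \<longrightarrow> int (k (i + 1)) \<ge> int (k i) - 1) \<longleftrightarrow>
      k a - 1 \<le> k (Suc a) \<and> (\<forall>i. Suc a \<le> i \<and> i < n \<longrightarrow> int (k (i + 1)) \<ge> int (k i) - 1)"
    by metis
  moreover have "map k [a..<Suc n] = k a # map k [Suc a..<Suc n]"
    using step.hyps by (simp add: upt_conv_Cons del: upt_Suc)
  ultimately show ?case
    using step.IH by (simp del: upt_Suc)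
qed

theorem mainTheorem1:
  fixes n :: nat and k :: "nat \<Rightarrow> nat"
  assumes "n \<ge> 1"
    and "\<forall>i\<in>{1..n}. k i \<ge> 1"
  shows "((\<forall>i. 1 \<le> i \<and> i < n \<longrightarrow> int (k (i + 1)) \<ge> int (k i) - 1) \<and> k n = 1 \<longrightarrow>
           measure_pmf.prob (sock_orderings n) {w. \<forall>i\<in>{1..n}. match_height w i = int (k i)}
             = 2 ^ n * (fact n * (\<Prod>i=1..n. real (k i)) / fact (2 * n)))
       \<and> (\<not> ((\<forall>i. 1 \<le> i \<and> i < n \<longrightarrow> int (k (i + 1)) \<ge> int (k i) - 1) \<and> k n = 1) \<longrightarrow>
           measure_pmf.prob (sock_orderings n) {w. \<forall>i\<in>{1..n}. match_height w i = int (k i)} = 0)"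
proof -
  define ks where "ks = map k [1..<Suc n]"
  let ?E = "{w. \<forall>i\<in>{1..n}. match_height w i = int (k i)}"
  have fin: "finite (socks n)" and card: "card (socks n) = 2 * n"
    by (simp_all add: socks_def)
  have "x \<notin> lone (socks n)" for x
  proof
    assume x: "x \<in> lone (socks n)"
    then have "(fst x, 1 - snd x) \<in> socks n - {x}"
      by (cases x) (auto simp: lone_def socks_def)
    then have "fst x \<in> fst ` (socks n - {x})" by (metis fst_conv image_eqI)
    then show False using x by (simp add: lone_def)
  qed
  then have lone: "lone (socks n) = {}" by blast
  have "w \<in> ?E \<longleftrightarrow> heights (int 0) w = map int ks" if "w \<in> permutations_of_set (socks n)" for w
    using heights_eq_map_match_height[OF that] by (auto simp: ks_def simp del: upt_Suc)
  then have "permutations_of_set (socks n) \<inter> ?E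
      = {w \<in> permutations_of_set (socks n). heights (int 0) w = map int ks}" by blast
  \<comment> \<open>Initially the table is empty and all \<open>n\<close> pairs are
    complete.\<close>
  also have "card \<dots> = height_count 0 n ks"
  proof (rule card_heights)
    show "length ks = 0 + n" by (simp add: ks_def)
  qed (use fin card lone in \<open>auto simp: socks_def\<close>)
  finally have "card (permutations_of_set (socks n) \<inter> ?E) = height_count 0 n ks" .
  then have prob: "measure_pmf.prob (sock_orderings n) ?E = height_count 0 n ks / fact (2 * n)"
    unfolding sock_orderings_def
    by (subst measure_pmf_of_set) (auto simp: fin card)
  have "prod_list ks = (\<Prod>i=1..n. k i)"
    unfolding ks_def
    by (simp add: prod.distinct_set_conv_list[symmetric] atLeastLessThanSuc_atLeastAtMost del: upt_Suc)
  \<comment> \<open>For \<open>t = 0\<close> the bound \<open>t \<le> k 1\<close> holds, which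
    leaves exactly the condition of the theorem.\<close>
  moreover have adm: "admissible 0 ks \<longleftrightarrow>
      (\<forall>i. 1 \<le> i \<and> i < n \<longrightarrow> int (k (i + 1)) \<ge> int (k i) - 1) \<and> k n = 1"
    using admissible_map_upt[of 1 n k 0] assms unfolding ks_def by blast
  ultimately show ?thesis
    unfolding prob height_count_def adm[symmetric] by simp
qed

end
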